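(* Let $\mathcal{G}$ be a graph on $M$ vertices with Laplacian $\mathbf{L}$, and let $R=f(\mathbf{L})$ for any (real-valued) $f$ injective on the spectrum of $\mathbf{L}$. Then for every $\sigma\in S_M$, $$\delta(\mathbf{P}_\sigma,R)=0\iff\sigma\in\operatorname{Aut}(\mathcal{G}).$$
   Context: $\mathbf{P}_\sigma$ is the permutation matrix of $\sigma$ (in the vertex basis), $[X,Y]=XY-YX$, and the commutativity residual is $\delta(A,R)=\|[R,A]\|_F/(\|R\|_F\|A\|_F)$ with $\|\cdot\|_F$ the Frobenius norm, so that $\delta(\mathbf P_\sigma,R)=0$ means $[R,\mathbf P_\sigma]=0$. The graph is finite, simple and undirected; $\mathbf{L}=\mathbf{D}-\mathbf{W}$ with $\mathbf D$ the degree and $\mathbf W$ the adjacency matrix; $\operatorname{Aut}(\mathcal{G})$ is its group of adjacency-preserving vertex permutations. Examples of $R$: $(\mathbf{I}+\mathbf{L})^{-1}$ and $\exp(-t\mathbf{L})$. *)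

theory Defs
  imports "HOL-Analysis.Analysis"
begin

section \<open>Graphs and their matrices\<close>

text \<open>A finite simple undirected graph on the vertex type \<open>'v\<close> is given by its adjacency relation;
  the number of vertices is \<open>CARD('v)\<close>.\<close>

definition simple_graph :: "('v::finite \<Rightarrow> 'v \<Rightarrow> bool) \<Rightarrow> bool" where
  "simple_graph E \<longleftrightarrow> symp E \<and> irreflp E"

definition diag_matrix :: "('v::finite \<Rightarrow> real) \<Rightarrow> real^'v^'v" where
  "diag_matrix d = (\<chi> i j. if i = j then d i else 0)"

definition adjacency_matrix :: "('v::finite \<Rightarrow> 'v \<Rightarrow> bool) \<Rightarrow> real^'v^'v" where
  "adjacency_matrix E = (\<chi> i j. if E i j then 1 else 0)"

definition degree_matrix :: "('v::finite \<Rightarrow> 'v \<Rightarrow> bool) \<Rightarrow> real^'v^'v" where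
  "degree_matrix E = diag_matrix (\<lambda>i. real (card {j. E i j}))"

definition laplacian :: "('v::finite \<Rightarrow> 'v \<Rightarrow> bool) \<Rightarrow> real^'v^'v" where
  "laplacian E = degree_matrix E - adjacency_matrix E"

definition graph_aut :: "('v::finite \<Rightarrow> 'v \<Rightarrow> bool) \<Rightarrow> ('v \<Rightarrow> 'v) set" where
  "graph_aut E = {\<sigma>. \<sigma> permutes UNIV \<and> (\<forall>u v. E (\<sigma> u) (\<sigma> v) \<longleftrightarrow> E u v)}"

text \<open>Convention: \<open>perm_matrix \<sigma>\<close> sends the basis vector of \<open>v\<close> to that of \<open>\<sigma> v\<close>.\<close>

definition perm_matrix :: "('v::finite \<Rightarrow> 'v) \<Rightarrow> real^'v^'v" where
  "perm_matrix \<sigma> = (\<chi> i j. if i = \<sigma> j then 1 else 0)"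

section \<open>Commutativity residual\<close>

definition commutator :: "real^'v^'v \<Rightarrow> real^'v^'v \<Rightarrow> real^'v^'v" where
  "commutator X Y = X ** Y - Y ** X"

text \<open>The type-class norm on matrices is the Frobenius norm.\<close>

lemma norm_matrix_eq_frobenius:
  fixes A :: "real^'n^'m"
  shows "norm A = sqrt (\<Sum>i\<in>UNIV. \<Sum>j\<in>UNIV. (A $ i $ j)\<^sup>2)"
  by (simp add: norm_vec_def L2_set_def sum_nonneg)

text \<open>If \<open>R = 0\<close>, the quotient is \<open>0 / 0 = 0\<close>, in agreement with \<open>[R,A] = 0\<close>.\<close>

definition comm_residual :: "real^'v^'v \<Rightarrow> real^'v^'v \<Rightarrow> real" where
  "comm_residual A R = norm (commutator R A) / (norm R * norm A)"

section \<open>Spectrum and functional calculus\<close>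

definition mat_spectrum :: "real^'v^'v \<Rightarrow> real set" where
  "mat_spectrum A = {c. \<exists>v. v \<noteq> 0 \<and> A *v v = c *\<^sub>R v}"

text \<open>\<open>f(A) = U diag(f(d\<^sub>1), \<dots>, f(d\<^sub>n)) U\<^sup>T\<close> for an orthogonal diagonalisation
  \<open>A = U diag(d\<^sub>1, \<dots>, d\<^sub>n) U\<^sup>T\<close>. For symmetric \<open>A\<close>, a diagonalisation exists and the result
  does not depend on its choice; see \<open>matrix_fun_eqI\<close> and \<open>symmetric_diagonalisable\<close> below.\<close>

definition matrix_fun :: "(real \<Rightarrow> real) \<Rightarrow> real^'v^'v \<Rightarrow> real^'v^'v" where
  "matrix_fun f A = (THE R. \<exists>U d. orthogonal_matrix U \<and>
      A = U ** diag_matrix d ** transpose U \<and>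
      R = U ** diag_matrix (\<lambda>i. f (d i)) ** transpose U)"

lemma diag_matrix_mult_right: "(A ** diag_matrix d) $ i $ j = A $ i $ j * d j"
  by (simp add: matrix_matrix_mult_def diag_matrix_def if_distrib[of "\<lambda>x. _ * x"] cong: if_cong)

lemma diag_matrix_mult_left: "(diag_matrix d ** A) $ i $ j = d i * A $ i $ j"
  by (simp add: matrix_matrix_mult_def diag_matrix_def if_distrib[of "\<lambda>x. x * _"] cong: if_cong)

lemma diagonalisation_unique:
  fixes U V :: "real^'v^'v"
  assumes U: "orthogonal_matrix U" and V: "orthogonal_matrix V"
    and eq: "U ** diag_matrix d ** transpose U = V ** diag_matrix e ** transpose V"
  shows "U ** diag_matrix (\<lambda>i. f (d i)) ** transpose U
       = V ** diag_matrix (\<lambda>i. f (e i)) ** transpose V"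
proof -
  define W where "W = transpose V ** U"
  have UU: "transpose U ** U = mat 1" "U ** transpose U = mat 1"
    and VV: "transpose V ** V = mat 1" "V ** transpose V = mat 1"
    using U V by (auto simp: orthogonal_matrix_def)
  have "W ** diag_matrix d = transpose V ** (U ** diag_matrix d ** transpose U) ** U"
    using UU by (metis W_def matrix_mul_assoc matrix_mul_rid)
  also have "\<dots> = diag_matrix e ** W"
    unfolding eq using VV by (metis W_def matrix_mul_assoc matrix_mul_lid)
  finally have WD: "W ** diag_matrix d = diag_matrix e ** W" .
  have "W $ i $ j * f (d j) = f (e i) * W $ i $ j" for i j
  proof -
    have "W $ i $ j * d j = e i * W $ i $ j"
      using WD by (metis diag_matrix_mult_left diag_matrix_mult_right)
    then show ?thesis by (cases "W $ i $ j = 0") auto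
  qed
  then have Wf: "W ** diag_matrix (\<lambda>i. f (d i)) = diag_matrix (\<lambda>i. f (e i)) ** W"
    by (simp add: vec_eq_iff diag_matrix_mult_left diag_matrix_mult_right)
  have VW: "V ** W = U"
    unfolding W_def using VV by (metis matrix_mul_assoc matrix_mul_lid)
  have WU: "W ** transpose U = transpose V"
    unfolding W_def using UU by (metis matrix_mul_assoc matrix_mul_rid)
  have "U ** diag_matrix (\<lambda>i. f (d i)) ** transpose U
      = V ** (W ** diag_matrix (\<lambda>i. f (d i))) ** transpose U"
    by (simp add: VW matrix_mul_assoc)
  also have "\<dots> = V ** diag_matrix (\<lambda>i. f (e i)) ** (W ** transpose U)"
    by (simp add: Wf matrix_mul_assoc)
  finally show ?thesis by (simp add: WU)
qed

lemma matrix_fun_eqI: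
  assumes "orthogonal_matrix U" "A = U ** diag_matrix d ** transpose U"
  shows "matrix_fun f A = U ** diag_matrix (\<lambda>i. f (d i)) ** transpose U"
  unfolding matrix_fun_def
proof (rule the_equality)
  show "\<exists>V e. orthogonal_matrix V \<and> A = V ** diag_matrix e ** transpose V \<and>
      U ** diag_matrix (\<lambda>i. f (d i)) ** transpose U = V ** diag_matrix (\<lambda>i. f (e i)) ** transpose V"
    using assms by blast
next
  fix R
  assume "\<exists>V e. orthogonal_matrix V \<and> A = V ** diag_matrix e ** transpose V \<and>
      R = V ** diag_matrix (\<lambda>i. f (e i)) ** transpose V"
  then show "R = U ** diag_matrix (\<lambda>i. f (d i)) ** transpose U"
    using assms diagonalisation_unique by metis
qed

lemma selfadjoint_eigenvector:
  fixes g :: "'a::euclidean_space \<Rightarrow> 'a"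
  assumes lin: "linear g" and adj: "\<And>x y. x \<bullet> g y = g x \<bullet> y"
    and S: "subspace S" "\<And>x. x \<in> S \<Longrightarrow> g x \<in> S" "S \<noteq> {0}"
  obtains u c where "u \<in> S" "norm u = 1" "g u = c *\<^sub>R u"
proof -
  let ?K = "S \<inter> sphere 0 1"
  have "0 \<in> S" using S(1) by (rule subspace_0)
  then obtain v where v: "v \<in> S" "v \<noteq> 0" using S(3) by blast
  have "v /\<^sub>R norm v \<in> ?K"
    using v S(1) by (simp add: subspace_scale)
  then have ne: "?K \<noteq> {}" by blast
  have comp: "compact ?K"
    using S(1) by (simp add: closed_subspace closed_Int_compact)
  have "continuous_on ?K (\<lambda>x. x \<bullet> g x)"
    by (intro continuous_intros linear_continuous_on lin linear_conv_bounded_linear[THEN iffD1])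
  then obtain u where u: "u \<in> ?K" and max: "\<And>x. x \<in> ?K \<Longrightarrow> x \<bullet> g x \<le> u \<bullet> g u"
    using continuous_attains_sup[OF comp ne] by blast
  define c where "c = u \<bullet> g u"
  have uS: "u \<in> S" and nu: "norm u = 1" using u by auto
  have uu: "u \<bullet> u = 1" using nu by (simp add: norm_eq_1)
  have bound: "x \<bullet> g x \<le> c * (x \<bullet> x)" if x: "x \<in> S" for x
  proof (cases "x = 0")
    case True
    then show ?thesis by simp
  next
    case False
    have "x /\<^sub>R norm x \<in> ?K" using x False S(1) by (simp add: subspace_scale)
    from max[OF this] have "inverse (norm x) * (inverse (norm x) * (x \<bullet> g x)) \<le> c"
      by (simp add: c_def linear_cmul[OF lin])
    then show ?thesis using False
      by (simp add: field_simps dot_square_norm power2_eq_square)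
  qed
  define w where "w = g u - c *\<^sub>R u"
  have wS: "w \<in> S" unfolding w_def using S uS by (simp add: subspace_diff subspace_scale)
  have "w \<bullet> w = 0"
  proof (rule ccontr)
    assume "w \<bullet> w \<noteq> 0"
    then have ww: "w \<bullet> w > 0" by simp
    define q where "q = c * (w \<bullet> w) - w \<bullet> g w"
    have q: "q \<ge> 0" using bound[OF wS] by (simp add: q_def)
    have gu: "g u = c *\<^sub>R u + w" by (simp add: w_def)
    have ugw: "u \<bullet> g w = c * (u \<bullet> w) + w \<bullet> w"
      using adj[of u w] by (simp add: gu inner_add_left)
    have uw: "u \<bullet> w = 0" by (simp add: w_def inner_diff_right uu c_def)
    have ineq: "2 * t * (w \<bullet> w) \<le> t\<^sup>2 * q" for t
    proof -
      have "u + t *\<^sub>R w \<in> S" using S(1) uS wS by (simp add: subspace_add subspace_scale)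
      from bound[OF this] show ?thesis
        by (simp add: linear_add[OF lin] linear_cmul[OF lin] inner_add_left inner_add_right
            gu ugw uw uu inner_commute[of w u] q_def algebra_simps power2_eq_square)
    qed
    define t where "t = w \<bullet> w / (q + 1)"
    have t: "t > 0" "t * (q + 1) = w \<bullet> w" using ww q by (simp_all add: t_def)
    have "t * (2 * (w \<bullet> w)) \<le> t * (t * q)"
      using ineq[of t] by (simp add: power2_eq_square algebra_simps)
    then have "2 * (w \<bullet> w) \<le> t * q" using t(1) by simp
    then have "w \<bullet> w + t \<le> 0" using t(2) by (simp add: algebra_simps)
    then show False using ww t(1) by simp
  qed
  then have "g u = c *\<^sub>R u" by (simp add: w_def)
  with uS nu that show thesis by blast
qed

lemma selfadjoint_eigenbasis:
  fixes g :: "'a::euclidean_space \<Rightarrow> 'a"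
  assumes lin: "linear g" and adj: "\<And>x y. x \<bullet> g y = g x \<bullet> y"
    and "subspace S" "\<And>x. x \<in> S \<Longrightarrow> g x \<in> S"
  shows "\<exists>B \<subseteq> S. pairwise orthogonal B \<and> span B = S \<and>
           (\<forall>b\<in>B. norm b = 1 \<and> (\<exists>c. g b = c *\<^sub>R b))"
  using assms(3,4)
proof (induction "dim S" arbitrary: S rule: less_induct)
  case less
  note S = less.prems
  show ?case
  proof (cases "S = {0}")
    case True
    then show ?thesis by (intro exI[of _ "{}"]) auto
  next
    case False
    obtain u c where u: "u \<in> S" "norm u = 1" "g u = c *\<^sub>R u"
      using selfadjoint_eigenvector[OF lin adj S False] by blast
    have uu: "u \<bullet> u = 1" using u(2) by (simp add: norm_eq_1)
    define T where "T = S \<inter> {x. u \<bullet> x = 0}"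
    have T: "subspace T"
      unfolding T_def using S(1) by (intro subspace_inter subspace_hyperplane)
    have invT: "g x \<in> T" if "x \<in> T" for x
      using that S(2) adj[of u x] u(3) by (auto simp: T_def)
    have "u \<notin> T" using uu by (simp add: T_def)
    then have "T \<subset> S" using u(1) unfolding T_def by blast
    then have "dim T < dim S"
      using T S(1) by (simp add: dim_psubset span_eq_iff[THEN iffD2])
    from less.hyps[OF this T invT] obtain B where B: "B \<subseteq> T" "pairwise orthogonal B" "span B = T"
      "\<forall>b\<in>B. norm b = 1 \<and> (\<exists>c. g b = c *\<^sub>R b)" by blast
    have "pairwise orthogonal (insert u B)"
      using B(1,2) by (auto simp: pairwise_insert T_def orthogonal_def inner_commute)
    moreover have "span (insert u B) = S"
    proof
      show "span (insert u B) \<subseteq> S"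
        using B(1) u(1) S(1) by (intro span_minimal) (auto simp: T_def)
      show "S \<subseteq> span (insert u B)"
      proof
        fix x assume x: "x \<in> S"
        have "x - (u \<bullet> x) *\<^sub>R u \<in> T"
          using x u(1) S(1) uu
          by (simp add: T_def subspace_diff subspace_scale inner_diff_right)
        then show "x \<in> span (insert u B)"
          using B(3) by (auto simp: span_insert)
      qed
    qed
    ultimately show ?thesis
      using B(1,4) u by (intro exI[of _ "insert u B"]) (auto simp: T_def)
  qed
qed

lemma symmetric_diagonalisable:
  fixes A :: "real^'v^'v"
  assumes sym: "transpose A = A"
  shows "\<exists>U d. orthogonal_matrix U \<and> A = U ** diag_matrix d ** transpose U"
proof -
  have adj: "x \<bullet> (A *v y) = (A *v x) \<bullet> y" for x y
    by (metis dot_lmul_matrix sym transpose_matrix_vector)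
  obtain B where B: "pairwise orthogonal B" "span B = (UNIV :: (real^'v) set)"
      "\<And>b. b \<in> B \<Longrightarrow> norm b = 1" "\<And>b. b \<in> B \<Longrightarrow> \<exists>c. A *v b = c *\<^sub>R b"
    using selfadjoint_eigenbasis[of "(*v) A" UNIV] adj by (auto simp: subspace_UNIV)
  have ind: "independent B"
    using B(1,3) by (intro pairwise_orthogonal_independent) fastforce+
  have "card B = CARD('v)"
    using ind B(2) by (metis dim_UNIV dim_eq_card_independent dim_span DIM_cart DIM_real mult.right_neutral)
  moreover have "finite B" using ind by (rule independent_imp_finite)
  ultimately obtain e where e: "bij_betw e (UNIV :: 'v set) B"
    using finite_same_card_bij[of "UNIV :: 'v set" B] by auto
  have eB: "e i \<in> B" for i using e by (auto simp: bij_betw_def)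
  obtain d where d: "\<And>i. A *v e i = d i *\<^sub>R e i" using B(4)[OF eB] by metis
  define U :: "real^'v^'v" where "U = (\<chi> i j. e j $ i)"
  have col: "column j U = e j" for j by (simp add: column_def U_def vec_eq_iff)
  have "orthogonal (e i) (e j)" if "i \<noteq> j" for i j
    using B(1) eB[of i] eB[of j] e that unfolding pairwise_def bij_betw_def inj_on_def by blast
  then have U: "orthogonal_matrix U"
    using B(3) eB by (simp add: orthogonal_matrix_orthonormal_columns col)
  have "(A ** U) $ i $ j = (A *v e j) $ i" for i j
    by (simp add: matrix_matrix_mult_def matrix_vector_mult_def U_def)
  then have "A ** U = U ** diag_matrix d"
    by (simp add: vec_eq_iff diag_matrix_mult_right d U_def)
  then have "A = U ** diag_matrix d ** transpose U"
    using U by (metis matrix_mul_assoc matrix_mul_rid orthogonal_matrix_def)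
  with U show ?thesis by blast
qed

end

theory Submission
  imports Defs
begin

text \<open>In an orthonormal eigenbasis of \<open>L\<close> with eigenvalues \<open>d\<^sub>i\<close>, a matrix with entries \<open>X\<^sub>i\<^sub>j\<close>
  commutes with \<open>f(L)\<close> iff \<open>f(d\<^sub>i) = f(d\<^sub>j)\<close> whenever \<open>X\<^sub>i\<^sub>j \<noteq> 0\<close>. For \<open>f\<close> injective on the spectrum this
  is the condition for commuting with \<open>L\<close> itself. A permutation matrix commutes with \<open>L\<close> iff the
  permutation preserves the entries of \<open>L\<close>; the off-diagonal entries are the negated adjacencies,
  and the degrees on the diagonal are preserved by every automorphism.\<close>

text \<open>Conjugation by \<open>U\<close> reduces the claim to commuting with
  \<open>diag_matrix d\<close>; entry \<open>(i, j)\<close> of that equation reads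
  \<open>d i * X $ i $ j = X $ i $ j * d j\<close>.\<close>

lemma commute_diagonalised_iff:
  fixes A U :: "real^'v^'v"
  assumes "orthogonal_matrix U"
  shows "(U ** diag_matrix d ** transpose U) ** A = A ** (U ** diag_matrix d ** transpose U) \<longleftrightarrow>
    (\<forall>i j. (transpose U ** A ** U) $ i $ j \<noteq> 0 \<longrightarrow> d i = d j)" (is "?lhs \<longleftrightarrow> ?rhs")
proof -
  define X where "X = transpose U ** A ** U"
  have UU: "transpose U ** U = mat 1" "U ** transpose U = mat 1"
    using assms by (auto simp: orthogonal_matrix_def)
  have conj_cancel: "U ** B ** transpose U = U ** C ** transpose U \<longleftrightarrow> B = C"
    for B C :: "real^'v^'v"
    by (metis UU(1) matrix_mul_assoc matrix_mul_lid matrix_mul_rid)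
  have "A = U ** X ** transpose U"
    unfolding X_def by (metis UU(2) matrix_mul_assoc matrix_mul_lid matrix_mul_rid)
  moreover have "(U ** B ** transpose U) ** (U ** C ** transpose U) = U ** (B ** C) ** transpose U"
    for B C :: "real^'v^'v"
    by (metis UU(1) matrix_mul_assoc matrix_mul_rid)
  ultimately have "?lhs \<longleftrightarrow> diag_matrix d ** X = X ** diag_matrix d"
    by (simp add: conj_cancel)
  also have "\<dots> \<longleftrightarrow> (\<forall>i j. X $ i $ j \<noteq> 0 \<longrightarrow> d i = d j)"
    by (auto simp: vec_eq_iff diag_matrix_mult_left diag_matrix_mult_right)
  finally show ?thesis by (simp add: X_def)
qed

text \<open>Column \<open>i\<close> of \<open>U\<close> is a unit eigenvector. This places the
  diagonal entries where \<open>f\<close> is known to be injective.\<close>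

lemma diagonalisation_eigenvalue:
  fixes U :: "real^'v^'v"
  assumes "orthogonal_matrix U" "A = U ** diag_matrix d ** transpose U"
  shows "d i \<in> mat_spectrum A"
proof -
  have "A ** U = U ** diag_matrix d"
    using assms by (metis matrix_mul_assoc matrix_mul_rid orthogonal_matrix_def)
  then have "(A ** U) $ k $ i = U $ k $ i * d i" for k
    by (simp add: diag_matrix_mult_right)
  then have "A *v column i U = d i *\<^sub>R column i U"
    by (simp add: vec_eq_iff matrix_matrix_mult_def matrix_vector_mult_def column_def mult.commute)
  moreover have "column i U \<noteq> 0"
    using assms(1) by (metis norm_zero orthogonal_matrix_orthonormal_columns zero_neq_one)
  ultimately show ?thesis
    by (auto simp: mat_spectrum_def)
qed

text \<open>The same \<open>U\<close> diagonalises \<open>L\<close> and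
  \<open>matrix_fun f L\<close>, so both sides test the same nonzero entries of
  \<open>transpose U ** A ** U\<close>.\<close>

lemma commute_matrix_fun_iff:
  fixes A L :: "real^'v^'v"
  assumes sym: "transpose L = L" and inj: "inj_on f (mat_spectrum L)"
  shows "matrix_fun f L ** A = A ** matrix_fun f L \<longleftrightarrow> L ** A = A ** L"
proof -
  obtain U d where U: "orthogonal_matrix U" and L: "L = U ** diag_matrix d ** transpose U"
    using symmetric_diagonalisable[OF sym] by blast
  have "f (d i) = f (d j) \<longleftrightarrow> d i = d j" for i j
    using inj_on_eq_iff[OF inj] diagonalisation_eigenvalue[OF U L] by blast
  then show ?thesis
    unfolding matrix_fun_eqI[OF U L]
    using commute_diagonalised_iff[OF U, of "\<lambda>i. f (d i)" A]
      commute_diagonalised_iff[OF U, of d A, folded L] by simp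
qed

text \<open>For \<open>R = 0\<close> both sides hold, the left one because division by zero yields
  0. Otherwise the denominator is positive.\<close>

lemma comm_residual_eq_0_iff:
  assumes "A \<noteq> 0"
  shows "comm_residual A R = 0 \<longleftrightarrow> R ** A = A ** R"
  using assms by (auto simp: comm_residual_def commutator_def)

lemma perm_matrix_neq_0: "perm_matrix \<sigma> \<noteq> 0"
proof
  assume "perm_matrix \<sigma> = 0"
  then have "perm_matrix \<sigma> $ \<sigma> undefined $ undefined = 0" by simp
  then show False by (simp add: perm_matrix_def)
qed

lemma commute_perm_matrix_iff:
  fixes A :: "real^'v^'v"
  assumes "\<sigma> permutes UNIV"
  shows "A ** perm_matrix \<sigma> = perm_matrix \<sigma> ** A \<longleftrightarrow> (\<forall>i j. A $ \<sigma> i $ \<sigma> j = A $ i $ j)"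
proof -
  have "(A ** perm_matrix \<sigma>) $ i $ j = A $ i $ \<sigma> j" for i j
    by (simp add: matrix_matrix_mult_def perm_matrix_def if_distrib[of "\<lambda>x. _ * x"] cong: if_cong)
  \<comment> \<open>In row \<open>\<sigma> i\<close> injectivity leaves only the summand with index
    \<open>i\<close>; by surjectivity every row has this form.\<close>
  moreover have "(perm_matrix \<sigma> ** A) $ \<sigma> i $ j = A $ i $ j" for i j
    using permutes_inj[OF assms]
    by (simp add: matrix_matrix_mult_def perm_matrix_def inj_eq if_distrib[of "\<lambda>x. x * _"] cong: if_cong)
  ultimately show ?thesis
    unfolding vec_eq_iff by (metis permutes_surj[OF assms] surjD)
qed

lemma laplacian_nth:
  "laplacian E $ i $ j = (if i = j then real (card {k. E i k}) else 0) - (if E i j then 1 else 0)"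
  by (simp add: laplacian_def degree_matrix_def diag_matrix_def adjacency_matrix_def)

lemma transpose_laplacian:
  assumes "symp E"
  shows "transpose (laplacian E) = laplacian E"
  using assms by (auto simp: vec_eq_iff transpose_def laplacian_nth dest: sympD)

text \<open>An automorphism maps the neighbourhood of \<open>i\<close> bijectively onto that of
  \<open>\<sigma> i\<close>.\<close>

lemma graph_aut_degree:
  assumes "\<sigma> \<in> graph_aut E"
  shows "card {k. E (\<sigma> i) k} = card {k. E i k}"
proof -
  have \<sigma>: "bij \<sigma>" "\<And>u v. E (\<sigma> u) (\<sigma> v) \<longleftrightarrow> E u v"
    using assms by (auto simp: graph_aut_def permutes_bij)
  have "{k. E (\<sigma> i) k} = \<sigma> ` {k. E i k}"
    using \<sigma> by (auto simp: image_iff) (metis bij_pointE)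
  then show ?thesis
    by (metis \<sigma>(1) bij_is_inj card_image inj_on_subset subset_UNIV)
qed

lemma graph_aut_iff_laplacian:
  assumes "irreflp E" "\<sigma> permutes UNIV"
  shows "\<sigma> \<in> graph_aut E \<longleftrightarrow> (\<forall>i j. laplacian E $ \<sigma> i $ \<sigma> j = laplacian E $ i $ j)"
proof
  have \<sigma>: "\<sigma> i = \<sigma> j \<longleftrightarrow> i = j" for i j
    using permutes_inj[OF assms(2)] by (simp add: inj_eq)
  show "\<forall>i j. laplacian E $ \<sigma> i $ \<sigma> j = laplacian E $ i $ j" if aut: "\<sigma> \<in> graph_aut E"
    using aut graph_aut_degree[OF aut] by (simp add: laplacian_nth \<sigma> graph_aut_def)
  show "\<sigma> \<in> graph_aut E" if L: "\<forall>i j. laplacian E $ \<sigma> i $ \<sigma> j = laplacian E $ i $ j"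
  proof -
    have "E (\<sigma> i) (\<sigma> j) \<longleftrightarrow> E i j" for i j
    \<comment> \<open>Diagonal entries of the Laplacian record degrees rather than adjacency, so the
      diagonal case uses the absence of loops.\<close>
    proof (cases "i = j")
      case True
      then show ?thesis using assms(1) by (simp add: irreflpD)
    next
      case False
      then show ?thesis
        using L[rule_format, of i j] by (simp add: laplacian_nth \<sigma> split: if_splits)
    qed
    then show ?thesis using assms(2) by (simp add: graph_aut_def)
  qed
qed

theorem theorem10p3:
  fixes E :: "'v::finite \<Rightarrow> 'v \<Rightarrow> bool"
    and f :: "real \<Rightarrow> real"
    and R :: "real^'v^'v"
    and \<sigma> :: "'v \<Rightarrow> 'v"
  assumes "simple_graph E"
    and "inj_on f (mat_spectrum (laplacian E))"
    and "R = matrix_fun f (laplacian E)"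
    and "\<sigma> permutes UNIV"
  shows "comm_residual (perm_matrix \<sigma>) R = 0 \<longleftrightarrow> \<sigma> \<in> graph_aut E"
proof -
  have E: "symp E" "irreflp E"
    using assms(1) by (auto simp: simple_graph_def)
  \<comment> \<open>Symmetry of \<open>E\<close> makes the Laplacian symmetric, hence orthogonally
    diagonalisable.\<close>
  have "comm_residual (perm_matrix \<sigma>) R = 0 \<longleftrightarrow>
      laplacian E ** perm_matrix \<sigma> = perm_matrix \<sigma> ** laplacian E"
    unfolding comm_residual_eq_0_iff[OF perm_matrix_neq_0] assms(3)
    by (rule commute_matrix_fun_iff[OF transpose_laplacian[OF E(1)] assms(2)])
  then show ?thesis
    by (simp add: commute_perm_matrix_iff[OF assms(4)] graph_aut_iff_laplacian[OF E(2) assms(4)])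
qed

end
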